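(* Let $0<\gamma<1$ and let $\omega(t)$ be a solution of the 2D incompressible Euler equations on $\mathbb{R}^2$ with bounded, compactly supported vorticity, whose initial vorticity $\omega_0$ satisfies $$|\omega_0(x)-\omega_0(y)|\le \frac{1}{|\log(|x-y|)|^{\gamma}}\qquad\text{for all } x\neq y \text{ with } |x-y|\le \tfrac12 .$$ Then this modulus of continuity is propagated in time: for every $t\ge 0$ there is a finite constant $C(t)$ such that $$|\omega(t,x)-\omega(t,y)|\le \frac{C(t)}{|\log(|x-y|)|^{\gamma}}\qquad\text{for all } x\neq y \text{ with } |x-y|\le \tfrac12 .$$
   Context: The 2D incompressible Euler equations in vorticity form on $\mathbb{R}^2$ are $$\partial_t\omega+u\cdot\nabla\omega=0,\qquad \nabla\cdot u=0,\qquad u=\nabla^\perp\Delta^{-1}\omega .$$ Solutions are the global unique (Yudovich) solutions with bounded, compactly supported vorticity; equivalently $\omega(t,x)=\omega_0(\Phi_t^{-1}(x))$, where $\Phi_t$ is the flow map, $\frac{d}{dt}\Phi_t(x)=u(t,\Phi_t(x))$, $\Phi_0(x)=x$. *)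

theory Defs
  imports "HOL-Analysis.Analysis"
begin

text \<open>
  \<open>\<Delta>\<^sup>-\<^sup>1 w\<close> is the Newtonian potential, i.e. the convolution of \<open>w\<close> with the fundamental
  solution \<open>ln |x| / (2 \<pi>)\<close> of the Laplacian on the plane.
\<close>

definition inv_laplacian :: "(real^2 \<Rightarrow> real) \<Rightarrow> real^2 \<Rightarrow> real" where
  "inv_laplacian w x = (LINT y|lborel. ln (norm (x - y)) / (2 * pi) * w y)"

definition partial_deriv :: "2 \<Rightarrow> (real^2 \<Rightarrow> real) \<Rightarrow> real^2 \<Rightarrow> real" where
  "partial_deriv i \<psi> x = deriv (\<lambda>s. \<psi> (x + s *\<^sub>R axis i 1)) 0"

text \<open>The sign convention \<open>(-\<partial>\<^sub>2, \<partial>\<^sub>1)\<close> makes \<open>curl (\<nabla>\<^sup>\<bottom> \<psi>) = \<Delta> \<psi>\<close>.\<close>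

definition perp_grad :: "(real^2 \<Rightarrow> real) \<Rightarrow> real^2 \<Rightarrow> real^2" where
  "perp_grad \<psi> x = vector [- partial_deriv 2 \<psi> x, partial_deriv 1 \<psi> x]"

definition velocity :: "(real^2 \<Rightarrow> real) \<Rightarrow> real^2 \<Rightarrow> real^2" where
  "velocity w = perp_grad (inv_laplacian w)"

text \<open>
  At \<open>t = 0\<close> the time derivative is one-sided. Joint continuity and bijectivity
  make every \<open>\<Phi> t\<close> a homeomorphism of the plane, by invariance of domain.
\<close>

definition is_flow_map ::
  "(real \<Rightarrow> real^2 \<Rightarrow> real^2) \<Rightarrow> (real \<Rightarrow> real^2 \<Rightarrow> real^2) \<Rightarrow> bool" where
  "is_flow_map u \<Phi> \<longleftrightarrow>
     (\<forall>x. \<Phi> 0 x = x) \<and>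
     (\<forall>t\<ge>0. \<forall>x. ((\<lambda>s. \<Phi> s x) has_vector_derivative u t (\<Phi> t x)) (at t within {0..})) \<and>
     continuous_on ({0..} \<times> UNIV) (\<lambda>(t, x). \<Phi> t x) \<and>
     (\<forall>t\<ge>0. bij (\<Phi> t))"

text \<open>
  Yudovich solutions in Lagrangian form: the vorticity is transported by the flow of the velocity
  field it generates. Only times \<open>t \<ge> 0\<close> matter.
\<close>

definition yudovich_solution :: "(real \<Rightarrow> real^2 \<Rightarrow> real) \<Rightarrow> bool" where
  "yudovich_solution \<omega> \<longleftrightarrow>
     (\<forall>t\<ge>0. \<omega> t \<in> borel_measurable borel \<and> bounded (range (\<omega> t)) \<and>
        compact (closure {x. \<omega> t x \<noteq> 0})) \<and>
     (\<exists>\<Phi>. is_flow_map (\<lambda>t. velocity (\<omega> t)) \<Phi> \<and>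
        (\<forall>t\<ge>0. \<forall>x. \<omega> t x = \<omega> 0 (inv (\<Phi> t) x)))"

end

theory Submission
  imports Defs
begin

text \<open>
  The velocity is log-Lipschitz, uniformly on \<open>[0, t]\<close>, because the vorticity keeps its supremum
  and stays supported in a fixed ball. By Gronwall, \<open>1 + ln (1 + 1 / |X - Y|\<^sup>2)\<close> for two trajectories
  \<open>X\<close>, \<open>Y\<close> changes by at most a factor \<open>e\<^sup>C\<^sup>t\<close>, i.e. \<open>|\<Phi>\<^sub>t\<^sup>-\<^sup>1 x - \<Phi>\<^sub>t\<^sup>-\<^sup>1 y|\<close> is bounded by a power of
  \<open>|x - y|\<close>. A logarithmic modulus of continuity only changes by a constant under such a map.

  Both the differentiability of the Newtonian potential and the log-Lipschitz bound reduce to the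
  integral of \<open>1 / (|x - y| |x' - y|)\<close> over \<open>y\<close> in a ball, which is \<open>O(1 + ln (1 / |x - x'|))\<close>: the
  first-order Taylor remainder of \<open>ln |z|\<close> is at most \<open>8 |h|\<^sup>2 / (|z| |z + h|)\<close>, and the inversion
  \<open>z / |z|\<^sup>2\<close> satisfies \<open>|a / |a|\<^sup>2 - b / |b|\<^sup>2| = |a - b| / (|a| |b|)\<close>.
\<close>

section \<open>Logarithmic weight and pointwise estimates for the logarithm and its gradient\<close>

text \<open>
  \<open>log_mod d\<close> is comparable to \<open>\<bar>ln d\<bar>\<close> for small \<open>d\<close>, but \<open>\<ge> 1\<close> for all \<open>d\<close>; its derivative
  \<open>-2 / (d (d\<^sup>2 + 1))\<close> makes the Gronwall argument global in \<open>d\<close>.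
\<close>

definition log_mod :: "real \<Rightarrow> real" where
  "log_mod d = 1 + ln (1 + 1 / d\<^sup>2)"

lemma log_mod_ge_1: "1 \<le> log_mod d"
  by (simp add: log_mod_def)

text \<open>Scale-free form of the Taylor remainder of \<open>ln |z|\<close>: dividing by
  \<open>|z|\<close>, the variables stand for \<open>b = |z + h| / |z|\<close>,
  \<open>q = |h| / |z|\<close> and \<open>r = z \<bullet> h / |z|\<^sup>2\<close>. Each case rests
  on \<open>ln x \<le> x - 1\<close>, applied to \<open>b\<close>, \<open>b\<^sup>2\<close> or their
  inverses.\<close>

lemma ln_deviation_bound:
  fixes b q r :: real
  assumes b: "0 < b" and q: "0 \<le> q" and b2: "b\<^sup>2 = 1 + 2 * r + q\<^sup>2"
    and r: "\<bar>r\<bar> \<le> q" and tri: "b \<le> 1 + q" "q \<le> 1 + b" "1 \<le> b + q"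
  shows "\<bar>ln b - r\<bar> \<le> 8 * q\<^sup>2 / b"
proof -
  have ln2: "ln (b\<^sup>2) = 2 * ln b"
    using b by (simp add: ln_realpow)
  have up: "ln b - r \<le> 8 * q\<^sup>2 / b"
  proof (cases "b \<le> 2")
    case True
    have "ln (b\<^sup>2) \<le> b\<^sup>2 - 1" using b by (intro ln_le_minus_one) simp
    then have "ln b - r \<le> q\<^sup>2 / 2" using ln2 b2 by simp
    also have "\<dots> \<le> 8 * q\<^sup>2 / b"
    proof -
      have "b * q\<^sup>2 \<le> 16 * q\<^sup>2" using True by (intro mult_right_mono) auto
      then show ?thesis using b by (simp add: field_simps)
    qed
    finally show ?thesis .
  next
    case False
    have "ln b \<le> b - 1" using b by (rule ln_le_minus_one)
    then have "ln b - r \<le> 2 * q" using tri r by linarith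
    also have "\<dots> \<le> 8 * q\<^sup>2 / b"
    proof -
      have "2 * q * b \<le> 2 * q * (4 * q)" using False tri q by (intro mult_left_mono) auto
      then show ?thesis using b by (simp add: field_simps power2_eq_square)
    qed
    finally show ?thesis .
  qed
  have lo: "r - ln b \<le> 8 * q\<^sup>2 / b"
  \<comment> \<open>Away from \<open>b = 0\<close> the terms linear in \<open>r\<close> cancel again
    and leave a numerator quadratic in \<open>q\<close>. For \<open>b < 1/2\<close> the triangle
    inequality forces \<open>q > 1/2\<close>, so the right-hand side exceeds \<open>2 / b\<close>,
    which beats the logarithm.\<close>
  proof (cases "1/2 \<le> b")
    case True
    have "ln (1 / b\<^sup>2) \<le> 1 / b\<^sup>2 - 1" using b by (intro ln_le_minus_one) simp
    then have "2 * ln b \<ge> 1 - 1 / b\<^sup>2" using ln2 b by (simp add: ln_div)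
    then have "r - ln b \<le> r - (1 - 1 / b\<^sup>2) / 2" by simp
    also have "\<dots> = (2 * r * (2 * r + q\<^sup>2) - q\<^sup>2) / (2 * b\<^sup>2)"
    proof -
      have "r - (1 - 1 / b\<^sup>2) / 2 = (2 * r * b\<^sup>2 - (b\<^sup>2 - 1)) / (2 * b\<^sup>2)"
        using b by (simp add: field_simps)
      also have "2 * r * b\<^sup>2 - (b\<^sup>2 - 1) = 2 * r * (2 * r + q\<^sup>2) - q\<^sup>2"
        unfolding b2 by (simp add: algebra_simps)
      finally show ?thesis .
    qed
    also have "\<dots> \<le> (16 * b * q\<^sup>2) / (2 * b\<^sup>2)"
    proof (rule divide_right_mono)
      have "r\<^sup>2 \<le> q\<^sup>2" using r by (simp add: abs_le_square_iff[symmetric])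
      moreover have "r * q\<^sup>2 \<le> q * q\<^sup>2" using r by (intro mult_right_mono) auto
      moreover have "q * q\<^sup>2 \<le> (1 + b) * q\<^sup>2" using tri by (intro mult_right_mono) auto
      moreover have "1 * q\<^sup>2 \<le> (2 * b) * q\<^sup>2" using True by (intro mult_right_mono) auto
      moreover have "0 \<le> b * q\<^sup>2" using b by simp
      ultimately show "2 * r * (2 * r + q\<^sup>2) - q\<^sup>2 \<le> 16 * b * q\<^sup>2"
        by (simp add: algebra_simps power2_eq_square)
    qed simp
    also have "\<dots> = 8 * q\<^sup>2 / b" using b by (simp add: power2_eq_square)
    finally show ?thesis .
  next
    case False
    have "ln (1 / b) \<le> 1 / b - 1" using b by (intro ln_le_minus_one) simp
    then have "r - ln b \<le> 1 / b + 1 / 2" using b tri r False by (simp add: ln_div)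
    also have "\<dots> \<le> 2 / b" using b False by (simp add: field_simps)
    also have "\<dots> \<le> 8 * q\<^sup>2 / b"
    proof (rule divide_right_mono)
      have "(1/2)\<^sup>2 \<le> q\<^sup>2" using False tri by (intro power_mono) auto
      then show "2 \<le> 8 * q\<^sup>2" by (simp add: power2_eq_square)
    qed (use b in simp)
    finally show ?thesis .
  qed
  show ?thesis using up lo by linarith
qed

text \<open>
  The singular denominator makes the bound hold without any smallness condition on \<open>h\<close>.
\<close>

lemma ln_norm_first_order:
  fixes z h :: "'a :: real_inner"
  assumes z: "z \<noteq> 0" and zh: "z + h \<noteq> 0"
  shows "\<bar>ln (norm (z + h)) - ln (norm z) - z \<bullet> h / (norm z)\<^sup>2\<bar>
    \<le> 8 * (norm h)\<^sup>2 / (norm z * norm (z + h))"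
proof -
  define a where "a = norm z"
  define b where "b = norm (z + h) / a"
  define q where "q = norm h / a"
  define r where "r = z \<bullet> h / a\<^sup>2"
  have a: "a > 0" using z by (simp add: a_def)
  have "\<bar>ln b - r\<bar> \<le> 8 * q\<^sup>2 / b"
  proof (rule ln_deviation_bound)
    show "0 < b" "0 \<le> q" using a zh by (auto simp: b_def q_def)
    have "(norm (z + h))\<^sup>2 = a\<^sup>2 + 2 * (z \<bullet> h) + (norm h)\<^sup>2"
      unfolding a_def by (simp add: power2_norm_eq_inner inner_add inner_commute algebra_simps)
    then show "b\<^sup>2 = 1 + 2 * r + q\<^sup>2"
      using a by (simp add: b_def q_def r_def field_simps)
    have "\<bar>z \<bullet> h\<bar> \<le> a * norm h" unfolding a_def by (rule Cauchy_Schwarz_ineq2)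
    then show "\<bar>r\<bar> \<le> q"
      using a by (simp add: r_def q_def abs_divide power2_eq_square field_simps)
    show "b \<le> 1 + q" 
      using a norm_triangle_ineq[of z h] by (simp add: b_def q_def field_simps flip: a_def)
    show "q \<le> 1 + b"
      using a norm_triangle_ineq4[of "z + h" z] by (simp add: b_def q_def field_simps flip: a_def)
    show "1 \<le> b + q"
      using a norm_triangle_ineq4[of "z + h" h] by (simp add: b_def q_def field_simps flip: a_def)
  qed
  moreover have "ln b = ln (norm (z + h)) - ln (norm z)"
    using a zh by (simp add: b_def a_def ln_div)
  moreover have "8 * q\<^sup>2 / b = 8 * (norm h)\<^sup>2 / (norm z * norm (z + h))"
    using a zh by (simp add: q_def b_def power2_eq_square flip: a_def)
  ultimately show ?thesis by (simp add: r_def a_def)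
qed

text \<open>\<open>x / |x|\<^sup>2\<close>, the gradient of \<open>ln |x|\<close>, is the inversion in the unit circle.\<close>

lemma norm_inversion_diff:
  fixes a b :: "'a :: real_inner"
  assumes "a \<noteq> 0" "b \<noteq> 0"
  shows "norm (a /\<^sub>R (norm a)\<^sup>2 - b /\<^sub>R (norm b)\<^sup>2) = norm (a - b) / (norm a * norm b)"
proof (rule power2_eq_imp_eq)
  have "(norm (a /\<^sub>R (norm a)\<^sup>2 - b /\<^sub>R (norm b)\<^sup>2))\<^sup>2 = (norm (a - b))\<^sup>2 / ((norm a)\<^sup>2 * (norm b)\<^sup>2)"
    unfolding power2_norm_eq_inner using assms
    by (simp add: inner_diff inner_commute field_simps)
  then show "(norm (a /\<^sub>R (norm a)\<^sup>2 - b /\<^sub>R (norm b)\<^sup>2))\<^sup>2 = (norm (a - b) / (norm a * norm b))\<^sup>2"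
    by (simp add: power_divide power_mult_distrib)
qed auto

section \<open>Integrals of kernels with one or two poles\<close>

text \<open>Division by zero makes the left-hand side \<open>0\<close> at \<open>r = 0\<close>.\<close>

lemma ennreal_dyadic_kernel_le:
  fixes r d :: real
  assumes r: "0 \<le> r" and d: "0 < d"
  shows "ennreal (1 / (r * max r d))
    \<le> 1 + (\<Sum>k. ennreal (2 ^ (k + 1) * min (2 ^ (k + 1)) (1 / d)) * indicator {..<(1/2) ^ k} r)"
    (is "_ \<le> 1 + (\<Sum>k. ?f k)")
proof -
  consider "r = 0" | "1 \<le> r" | "0 < r" "r < 1" using r by linarith
  then show ?thesis
  proof cases
    case 1 then show ?thesis by simp
  next
    case 2
    have "1 * 1 \<le> r * max r d" using 2 by (intro mult_mono) auto
    then have "ennreal (1 / (r * max r d)) \<le> 1"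
      by (simp add: ennreal_le_1)
    then show ?thesis by (intro add_increasing2) auto
  next
    case 3
    \<comment> \<open>One term of the series suffices, the one for the dyadic shell containing
      \<open>r\<close>. Since \<open>r < 1\<close>, the least \<open>n\<close> is positive and its
      predecessor \<open>k\<close> satisfies
      \<open>(1/2) ^ (k + 1) \<le> r < (1/2) ^ k\<close>.\<close>
    define n where "n = (LEAST n. (1/2) ^ n \<le> r)"
    have ex: "\<exists>n. (1/2) ^ n \<le> r"
      using real_arch_pow_inv[of r "1/2"] 3 by (auto intro: less_imp_le)
    have n: "(1/2) ^ n \<le> r" unfolding n_def using ex by (rule LeastI_ex)
    have "n \<noteq> 0" using n 3 by (intro notI) simp
    then obtain k where k: "n = Suc k" by (cases n) auto
    have rk: "r < (1/2) ^ k"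
      using not_less_Least[of k "\<lambda>n. (1/2) ^ n \<le> r"] k unfolding n_def[symmetric] by simp
    have r2: "1 / r \<le> 2 ^ (k + 1)"
      using n 3 by (simp add: k power_one_over field_simps)
    have "1 / (r * max r d) = 1 / r * (1 / max r d)" by simp
    also have "\<dots> \<le> 2 ^ (k + 1) * min (2 ^ (k + 1)) (1 / d)"
    proof (rule mult_mono[OF r2])
      have "1 / max r d \<le> 1 / r" "1 / max r d \<le> 1 / d"
        using 3 d by (auto intro!: divide_left_mono mult_pos_pos simp: max_def)
      then show "1 / max r d \<le> min (2 ^ (k + 1)) (1 / d)" using r2 by simp
    qed (use 3 in auto)
    finally have "ennreal (1 / (r * max r d)) \<le> ?f k" using rk by (simp add: ennreal_leI)
    also have "\<dots> \<le> (\<Sum>k. ?f k)"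
      using sum_le_suminf[of ?f "{k}"] by (simp del: power_Suc sum_mult_indicator)
    finally show ?thesis by (intro add_increasing) auto
  qed
qed

text \<open>The logarithm counts scales: about \<open>log 2 (1 / d)\<close> terms have size 2, one
  for each dyadic scale above \<open>d\<close>, and the remaining ones form a geometric
  tail.\<close>

lemma suminf_dyadic_min_le:
  fixes d :: real
  assumes d: "0 < d"
  shows "(\<Sum>k. ennreal (2 * pi * min 2 ((1/2) ^ k / d))) \<le> ennreal (8 * pi * log_mod d)"
proof -
  \<comment> \<open>For \<open>d \<ge> 1\<close> the logarithm is nonpositive and \<open>nat\<close>
    truncates it to \<open>n = 0\<close>, so only the geometric tail remains.\<close>
  define n where "n = nat \<lceil>log 2 (1 / d)\<rceil>"
  define g :: "nat \<Rightarrow> real" where "g k = (if k < n then 2 else (1/2) ^ (k - n))" for k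
  have nd: "(1/2) ^ n \<le> d"
  proof -
    have "log 2 (1 / d) \<le> real n" unfolding n_def by (rule real_nat_ceiling_ge)
    then have "1 / d \<le> 2 powr real n" using d by (simp add: log_le_iff)
    then show ?thesis using d by (simp add: powr_realpow power_one_over field_simps)
  qed
  have le: "min 2 ((1/2) ^ k / d) \<le> g k" for k
  proof (cases "k < n")
    case False
    then have "(1/2) ^ k = ((1/2) ^ (k - n) * (1/2) ^ n :: real)"
      by (simp flip: power_add)
    also have "\<dots> \<le> (1/2) ^ (k - n) * d" using nd by (intro mult_left_mono) auto
    finally have "(1/2) ^ k / d \<le> (1/2) ^ (k - n)" using d by (simp add: pos_divide_le_eq)
    then show ?thesis using False by (simp add: g_def)
  qed (simp add: g_def)
  have "(\<lambda>k. g (k + n)) sums 2"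
    using geometric_sums[of "1/2 :: real"] by (simp add: g_def)
  then have "g sums (2 + (\<Sum>k<n. g k))" by (simp add: sums_iff_shift)
  moreover have "(\<Sum>k<n. g k) = 2 * n" by (simp add: g_def)
  ultimately have "g sums (2 + 2 * real n)" by simp
  then have g: "(\<lambda>k. 2 * pi * g k) sums (2 * pi * (2 + 2 * real n))" by (rule sums_mult)
  have g0: "0 \<le> g k" for k by (simp add: g_def)
  have "(\<Sum>k. ennreal (2 * pi * min 2 ((1/2) ^ k / d))) \<le> (\<Sum>k. ennreal (2 * pi * g k))"
    using le by (intro suminf_le summableI ennreal_leI mult_left_mono) auto
  also have "\<dots> = ennreal (2 * pi * (2 + 2 * real n))"
    using g g0 by (subst suminf_ennreal2) (auto simp: sums_iff)
  also have "\<dots> \<le> ennreal (8 * pi * log_mod d)"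
  proof (rule ennreal_leI)
    have ln2: "1/2 \<le> (ln 2 :: real)" using ln_le_minus_one[of "1/2 :: real"] by (simp add: ln_div)
    define l where "l = ln (1 + 1 / d\<^sup>2)"
    have "real n \<le> 1 + l"
    proof (cases "d \<le> 1")
      case True
      have "ln (1 / d) * 2 = ln (1 / d\<^sup>2)" using d by (simp add: ln_div ln_realpow)
      also have "\<dots> \<le> l" unfolding l_def using d by (intro ln_mono) auto
      finally have *: "ln (1 / d) \<le> l / 2" by simp
      have "0 \<le> ln (1 / d)" using True d by simp
      then have "log 2 (1 / d) \<le> ln (1 / d) / (1/2)"
        unfolding log_def using ln2 by (intro divide_left_mono) auto
      then have "log 2 (1 / d) \<le> l" using * by simp
      moreover have "0 \<le> log 2 (1 / d)" using True d by simp
      then have "real n \<le> 1 + log 2 (1 / d)" unfolding n_def by linarith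
      ultimately show ?thesis by simp
    next
      case False
      then have "log 2 (1 / d) \<le> 0" using d by (simp add: log_divide)
      then have "n = 0" by (simp add: n_def)
      then show ?thesis by (simp add: l_def)
    qed
    moreover have "0 \<le> l" by (simp add: l_def)
    ultimately have "2 + 2 * real n \<le> 4 + 4 * l" by auto
    then have "2 + 2 * real n \<le> 4 * log_mod d"
      by (simp add: log_mod_def l_def)
    then have "2 * pi * (2 + 2 * real n) \<le> 2 * pi * (4 * log_mod d)" by (intro mult_left_mono) auto
    then show "2 * pi * (2 + 2 * real n) \<le> 8 * pi * log_mod d" by simp
  qed
  finally show ?thesis .
qed

text \<open>The kernel is summed over dyadic balls around the pole. The area
  \<open>pi / 4 ^ k\<close> of the \<open>k\<close>-th ball cancels the singularity of order two
  down to scale \<open>d\<close>, so each such scale contributes a constant.\<close>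

lemma nn_integral_one_pole_le:
  fixes x :: "real^2"
  assumes S: "S \<in> sets borel" "emeasure lborel S < \<infinity>" and d: "0 < d"
  shows "(\<integral>\<^sup>+y. ennreal (1 / (norm (x - y) * max (norm (x - y)) d)) * indicator S y \<partial>lborel)
    \<le> ennreal ((measure lborel S + 8 * pi) * log_mod d)"
proof -
  have [measurable]: "ball x r \<in> sets borel" for r by simp
  define c where "c k = ennreal (2 ^ (k + 1) * min (2 ^ (k + 1)) (1 / d))" for k
  have "(\<integral>\<^sup>+y. ennreal (1 / (norm (x - y) * max (norm (x - y)) d)) * indicator S y \<partial>lborel)
    \<le> (\<integral>\<^sup>+y. indicator S y + (\<Sum>k. c k * indicator (ball x ((1/2) ^ k)) y) \<partial>lborel)"
  proof (rule nn_integral_mono)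
    fix y
    have "ennreal (1 / (norm (x - y) * max (norm (x - y)) d))
      \<le> 1 + (\<Sum>k. c k * indicator {..<(1/2) ^ k} (norm (x - y)))"
      unfolding c_def using d by (intro ennreal_dyadic_kernel_le) auto
    also have "(\<lambda>k. c k * indicator {..<(1/2) ^ k} (norm (x - y)))
      = (\<lambda>k. c k * indicator (ball x ((1/2) ^ k)) y)"
      by (auto simp: indicator_def dist_norm)
    finally show "ennreal (1 / (norm (x - y) * max (norm (x - y)) d)) * indicator S y
      \<le> indicator S y + (\<Sum>k. c k * indicator (ball x ((1/2) ^ k)) y)"
      by (auto simp: indicator_def)
  qed
  also have "\<dots> = emeasure lborel S + (\<Sum>k. c k * emeasure lborel (ball x ((1/2) ^ k)))"
    using S by (simp add: nn_integral_add nn_integral_suminf nn_integral_cmult_indicator)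
  also have "(\<lambda>k. c k * emeasure lborel (ball x ((1/2) ^ k)))
    = (\<lambda>k. ennreal (2 * pi * min 2 ((1/2) ^ k / d)))"
  proof
    fix k
    have "c k * emeasure lborel (ball x ((1/2) ^ k))
      = ennreal (2 ^ (k + 1) * min (2 ^ (k + 1)) (1 / d) * (pi * ((1/2) ^ k)\<^sup>2))"
      unfolding c_def using d by (simp add: emeasure_ball unit_ball_vol_2 ennreal_mult'')
    also have "2 ^ (k + 1) * min (2 ^ (k + 1)) (1 / d) * (pi * ((1/2) ^ k)\<^sup>2)
      = 2 * pi * ((1/2) ^ k * min (2 ^ (k + 1)) (1 / d))"
      by (simp add: power_one_over power2_eq_square)
    also have "(1/2) ^ k * min (2 ^ (k + 1)) (1 / d) = min 2 ((1/2) ^ k / d)"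
      by (subst min_mult_distrib_left) (simp add: power_one_over)
    finally show "c k * emeasure lborel (ball x ((1/2) ^ k))
      = ennreal (2 * pi * min 2 ((1/2) ^ k / d))" .
  qed
  also have "emeasure lborel S + (\<Sum>k. ennreal (2 * pi * min 2 ((1/2) ^ k / d)))
    \<le> ennreal (measure lborel S) + ennreal (8 * pi * log_mod d)"
    using S d by (intro add_mono suminf_dyadic_min_le) (auto simp: emeasure_eq_ennreal_measure)
  also have "\<dots> = ennreal (measure lborel S + 8 * pi * log_mod d)"
    using log_mod_ge_1[of d] by (intro ennreal_plus[symmetric]) auto
  also have "\<dots> \<le> ennreal ((measure lborel S + 8 * pi) * log_mod d)"
    \<comment> \<open>Because \<open>log_mod d \<ge> 1\<close>, the measure of \<open>S\<close> can
      be absorbed into a multiple of \<open>log_mod d\<close>.\<close>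
    using mult_left_mono[OF log_mod_ge_1[of d], of "measure lborel S"]
    by (intro ennreal_leI) (simp add: algebra_simps)
  finally show ?thesis .
qed

definition two_pole :: "'a :: real_normed_vector \<Rightarrow> 'a \<Rightarrow> 'a \<Rightarrow> real" where
  "two_pole x x' y = 1 / (norm (x - y) * norm (x' - y))"

lemma nn_integral_two_pole_le:
  fixes x x' :: "real^2"
  assumes S: "S \<in> sets borel" "emeasure lborel S < \<infinity>" and xx': "x \<noteq> x'"
  shows "(\<integral>\<^sup>+y. ennreal (two_pole x x' y * indicator S y) \<partial>lborel)
    \<le> ennreal (2 * (measure lborel S + 8 * pi) * log_mod (norm (x - x')))"
proof -
  define d where "d = norm (x - x')"
  define f where "f z y = ennreal (1 / (norm (z - y) * max (norm (z - y)) d)) * indicator S y" for z y :: "real^2"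
  have d: "d > 0" using xx' by (simp add: d_def)
  have "(\<integral>\<^sup>+y. ennreal (two_pole x x' y * indicator S y) \<partial>lborel)
    \<le> (\<integral>\<^sup>+y. f x y + f x' y \<partial>lborel)"
  proof (rule nn_integral_mono)
    fix y
    define a b where "a = norm (x - y)" and "b = norm (x' - y)"
    have tri: "d \<le> a + b" unfolding a_def b_def d_def
      using norm_triangle_ineq4[of "x - y" "x' - y"] by simp
    have "1 / (a * b) \<le> 1 / (a * max a d) + 1 / (b * max b d)"
    \<comment> \<open>At a pole the left-hand side is 0 by division by zero.\<close>
    proof (cases "a = 0 \<or> b = 0")
      case True
      have "0 \<le> a" "0 \<le> b" by (auto simp: a_def b_def)
      then show ?thesis using True d by auto
    next
      case False
      then have ab: "0 < a" "0 < b" by (auto simp: a_def b_def)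
      \<comment> \<open>Partial fractions separate the two poles; the triangle inequality
        \<open>d \<le> a + b\<close> then supplies the cutoff \<open>max a d\<close> at each of
        them.\<close>
      have "1 / (a * b) = 1 / (a * (a + b)) + 1 / (b * (a + b))"
        using ab by (simp add: divide_simps)
      also have "\<dots> \<le> 1 / (a * max a d) + 1 / (b * max b d)"
        using ab tri d
        by (intro add_mono divide_left_mono mult_left_mono mult_pos_pos) auto
      finally show ?thesis .
    qed
    then have "ennreal (1 / (a * b)) \<le> ennreal (1 / (a * max a d) + 1 / (b * max b d))"
      by (rule ennreal_leI)
    also have "\<dots> = ennreal (1 / (a * max a d)) + ennreal (1 / (b * max b d))"
      using d by (intro ennreal_plus) (auto simp: a_def b_def max_def)
    finally show "ennreal (two_pole x x' y * indicator S y) \<le> f x y + f x' y"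
      by (simp add: f_def two_pole_def a_def b_def indicator_def)
  qed
  also have "\<dots> = (\<integral>\<^sup>+y. f x y \<partial>lborel) + (\<integral>\<^sup>+y. f x' y \<partial>lborel)"
    using S by (intro nn_integral_add) (auto simp: f_def)
  also have "\<dots> \<le> ennreal ((measure lborel S + 8 * pi) * log_mod d)
      + ennreal ((measure lborel S + 8 * pi) * log_mod d)"
    unfolding f_def using S d by (intro add_mono nn_integral_one_pole_le)
  also have "\<dots> = ennreal (2 * (measure lborel S + 8 * pi) * log_mod d)"
    using log_mod_ge_1[of d] by (subst ennreal_plus[symmetric]) (auto simp: mult.assoc)
  finally show ?thesis by (simp add: d_def)
qed

lemma
  fixes x x' :: "real^2"
  assumes S: "S \<in> sets borel" "emeasure lborel S < \<infinity>" and xx': "x \<noteq> x'"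
  shows integrable_two_pole: "integrable lborel (\<lambda>y. two_pole x x' y * indicator S y)"
    and integral_two_pole_le: "(LINT y|lborel. two_pole x x' y * indicator S y)
      \<le> 2 * (measure lborel S + 8 * pi) * log_mod (norm (x - x'))"
proof -
  have m: "(\<lambda>y. two_pole x x' y * indicator S y) \<in> borel_measurable lborel"
    using S unfolding two_pole_def by measurable
  have nonneg: "0 \<le> two_pole x x' y * indicator S y" for y by (simp add: two_pole_def)
  note le = nn_integral_two_pole_le[OF S xx']
  show int: "integrable lborel (\<lambda>y. two_pole x x' y * indicator S y)"
    using le nonneg by (intro integrableI_nonneg m) (auto intro: le_less_trans)
  have "0 \<le> 2 * (measure lborel S + 8 * pi) * log_mod (norm (x - x'))"
    using log_mod_ge_1[of "norm (x - x')"] by simp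
  then show "(LINT y|lborel. two_pole x x' y * indicator S y)
      \<le> 2 * (measure lborel S + 8 * pi) * log_mod (norm (x - x'))"
    using le by (subst (asm) nn_integral_eq_integral[OF int]) (use nonneg in auto)
qed

text \<open>Common interface for the Taylor remainder of the potential and for differences of the
  velocity kernel: both are controlled by \<open>two_pole\<close> away from the poles, hence almost
  everywhere.\<close>

lemma
  fixes f :: "real^2 \<Rightarrow> real"
  assumes f: "f \<in> borel_measurable lborel"
    and S: "S \<in> sets borel" "emeasure lborel S < \<infinity>" and xx': "x \<noteq> x'"
    and le: "AE y in lborel. \<bar>f y\<bar> \<le> B * (two_pole x x' y * indicator S y)"
  shows integrable_of_two_pole: "integrable lborel f"
    and integral_of_two_pole_le: "0 \<le> B \<Longrightarrow>
      \<bar>LINT y|lborel. f y\<bar> \<le> B * (2 * (measure lborel S + 8 * pi) * log_mod (norm (x - x')))"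
proof -
  have int: "integrable lborel (\<lambda>y. B * (two_pole x x' y * indicator S y))"
    using integrable_two_pole[OF S xx'] by simp
  show f': "integrable lborel f"
    by (rule Bochner_Integration.integrable_bound[OF int f]) (use le in eventually_elim, simp)
  assume B: "0 \<le> B"
  have "\<bar>LINT y|lborel. f y\<bar> \<le> (LINT y|lborel. \<bar>f y\<bar>)" by (rule integral_abs_bound)
  also have "\<dots> \<le> (LINT y|lborel. B * (two_pole x x' y * indicator S y))"
    using f' int le by (intro integral_mono_AE) auto
  also have "\<dots> \<le> B * (2 * (measure lborel S + 8 * pi) * log_mod (norm (x - x')))"
    using integral_two_pole_le[OF S xx'] B by (simp add: mult_left_mono)
  finally show "\<bar>LINT y|lborel. f y\<bar> \<le> B * (2 * (measure lborel S + 8 * pi) * log_mod (norm (x - x')))" .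
qed

text \<open>Reduction to two poles: a second pole \<open>x'\<close> is placed at distance 1 from
  \<open>x\<close>. On the ball \<open>|x' - y|\<close> is at most \<open>|x'| + R\<close>, so the
  extra factor in the denominator costs only a constant.\<close>

lemma integrable_of_pole:
  fixes f :: "real^2 \<Rightarrow> real"
  assumes f: "f \<in> borel_measurable lborel" and B: "0 \<le> B"
    and le: "AE y in lborel. \<bar>f y\<bar> \<le> B / norm (x - y) * indicator (cball 0 R) y"
  shows "integrable lborel f"
proof -
  define x' :: "real^2" where "x' = x + axis 1 1"
  have xx': "x \<noteq> x'" by (simp add: x'_def axis_eq_0_iff)
  have "AE y in lborel. \<bar>f y\<bar> \<le> (B * (norm x' + R)) * (two_pole x x' y * indicator (cball 0 R) y)"
    using le AE_lborel_singleton[of x'] AE_lborel_singleton[of x]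
  proof eventually_elim
    case (elim y)
    show ?case
    proof (cases "y \<in> cball 0 R")
      case True
      have "norm (x' - y) \<le> norm x' + R"
        using norm_triangle_ineq4[of x' y] True by simp
      then have "B / norm (x - y) * norm (x' - y) \<le> B / norm (x - y) * (norm x' + R)"
        using B by (intro mult_left_mono) auto
      then have "B / norm (x - y) \<le> B * (norm x' + R) * two_pole x x' y"
        using elim by (simp add: two_pole_def field_simps)
      then show ?thesis using elim True by simp
    qed (use elim in simp)
  qed
  then show ?thesis
    by (rule integrable_of_two_pole[OF f _ _ xx', rotated 2]) (simp, rule emeasure_bounded_finite, simp)
qed

section \<open>The Biot-Savart law and the log-Lipschitz bound for the velocity\<close>

definition directional_kernel :: "'a :: real_inner \<Rightarrow> 'a \<Rightarrow> 'a \<Rightarrow> real" where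
  "directional_kernel e x y = (x - y) \<bullet> e / (norm (x - y))\<^sup>2"

text \<open>The kernel is the derivative of \<open>ln |x - y|\<close> in \<open>x\<close> along
  \<open>e\<close>, so this is the candidate for the derivative of the Newtonian potential along
  \<open>e\<close>. Keeping \<open>e\<close> as a parameter treats both velocity components, and a
  whole increment \<open>h\<close>, at once.\<close>

definition biot_savart :: "(real^2 \<Rightarrow> real) \<Rightarrow> real^2 \<Rightarrow> real^2 \<Rightarrow> real" where
  "biot_savart w e x = (LINT y|lborel. directional_kernel e x y / (2 * pi) * w y)"

lemma biot_savart_scaleR: "biot_savart w (s *\<^sub>R e) x = s * biot_savart w e x"
  by (simp add: biot_savart_def directional_kernel_def flip: integral_mult_right_zero)
    (simp add: mult_ac)

lemma directional_kernel_diff_le: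
  assumes "y \<noteq> x" "y \<noteq> x'"
  shows "\<bar>directional_kernel e x y - directional_kernel e x' y\<bar>
    \<le> norm e * norm (x - x') * two_pole x x' y"
proof -
  have "directional_kernel e x y - directional_kernel e x' y
    = ((x - y) /\<^sub>R (norm (x - y))\<^sup>2 - (x' - y) /\<^sub>R (norm (x' - y))\<^sup>2) \<bullet> e"
    by (simp add: directional_kernel_def inner_diff_left divide_inverse mult.commute)
  also have "\<bar>\<dots>\<bar> \<le> norm ((x - y) /\<^sub>R (norm (x - y))\<^sup>2 - (x' - y) /\<^sub>R (norm (x' - y))\<^sup>2) * norm e"
    by (rule Cauchy_Schwarz_ineq2)
  also have "\<dots> = norm e * norm (x - x') * two_pole x x' y"
    using assms by (subst norm_inversion_diff) (auto simp: two_pole_def)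
  finally show ?thesis .
qed

text \<open>This makes a remainder of size \<open>s\<^sup>2 * log_mod s\<close> negligible after
  division by \<open>s\<close>, which gives differentiability of the potential.\<close>

lemma tendsto_mult_log_mod: "((\<lambda>s. \<bar>s\<bar> * log_mod \<bar>s\<bar>) \<longlongrightarrow> 0) (at 0)"
proof (rule Lim_null_comparison)
  have "\<bar>s\<bar> * log_mod \<bar>s\<bar> \<le> \<bar>s\<bar> + 4 * sqrt (\<bar>s\<bar>\<^sup>2 + \<bar>s\<bar>)" if "s \<noteq> 0" for s :: real
  proof -
    define d where "d = \<bar>s\<bar>"
    have d: "d > 0" using that by (simp add: d_def)
    \<comment> \<open>Taking a fourth root before using \<open>ln x \<le> x - 1\<close> leaves
      growth of order \<open>1 / sqrt d\<close> only, which the factor \<open>d\<close>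
      overcomes.\<close>
    have "ln (1 + 1 / d\<^sup>2) \<le> ln ((sqrt (1 + 1 / d)) ^ 4)"
    proof (rule ln_mono)
      have "sqrt (1 + 1 / d) ^ 4 = (1 + 1 / d)\<^sup>2"
        using d power_mult[of "sqrt (1 + 1 / d)" 2 2] by simp
      then show "1 + 1 / d\<^sup>2 \<le> sqrt (1 + 1 / d) ^ 4"
        using d by (simp add: power2_sum power_one_over)
    qed (use d in \<open>simp add: add_pos_pos\<close>)
    also have "\<dots> = 4 * ln (sqrt (1 + 1 / d))" using d by (simp add: ln_realpow add_pos_pos)
    also have "\<dots> \<le> 4 * sqrt (1 + 1 / d)"
      using d ln_le_minus_one[of "sqrt (1 + 1 / d)"] by (simp add: add_pos_pos)
    finally have "d * log_mod d \<le> d * (1 + 4 * sqrt (1 + 1 / d))"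
      using d by (simp add: log_mod_def)
    also have "\<dots> = d + 4 * (sqrt (d\<^sup>2) * sqrt (1 + 1 / d))" using d by (simp add: algebra_simps)
    also have "sqrt (d\<^sup>2) * sqrt (1 + 1 / d) = sqrt (d\<^sup>2 + d)"
      unfolding real_sqrt_mult[symmetric] using d by (simp add: algebra_simps power2_eq_square)
    finally show ?thesis by (simp add: d_def)
  qed
  then show "\<forall>\<^sub>F s in at 0. norm (\<bar>s\<bar> * log_mod \<bar>s\<bar>) \<le> \<bar>s\<bar> + 4 * sqrt (\<bar>s\<bar>\<^sup>2 + \<bar>s\<bar>)"
    using log_mod_ge_1 by (auto simp: eventually_at_filter abs_mult abs_of_pos less_le_trans[OF zero_less_one])
  show "((\<lambda>s. \<bar>s\<bar> + 4 * sqrt (\<bar>s\<bar>\<^sup>2 + \<bar>s\<bar>)) \<longlongrightarrow> 0) (at (0::real))"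
    by (auto intro!: tendsto_eq_intros)
qed

text \<open>With \<open>M\<close> and \<open>R\<close> as parameters, all vorticities at times in a
  bounded interval can share the same constants.\<close>

locale bounded_vorticity =
  fixes w :: "real^2 \<Rightarrow> real" and M R :: real
  assumes measurable_w [measurable]: "w \<in> borel_measurable borel"
    and M: "0 \<le> M"
    and w_le: "\<bar>w y\<bar> \<le> M * indicator (cball 0 R) y"
begin

definition modulus_const :: real where
  "modulus_const = 2 * (measure lborel (cball (0 :: real^2) R) + 8 * pi)"

lemma w_le_M: "\<bar>w y\<bar> \<le> M"
  using w_le[of y] M by (cases "norm y \<le> R") auto

lemma integral_of_two_pole_cball_le:
  fixes f :: "real^2 \<Rightarrow> real"
  assumes "f \<in> borel_measurable lborel" "x \<noteq> x'" "0 \<le> B"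
    and "AE y in lborel. \<bar>f y\<bar> \<le> B * (two_pole x x' y * indicator (cball 0 R) y)"
  shows "\<bar>LINT y|lborel. f y\<bar> \<le> B * (modulus_const * log_mod (norm (x - x')))"
  using integral_of_two_pole_le[OF assms(1) _ _ assms(2,4,3)] emeasure_bounded_finite[of "cball 0 R"]
  by (simp add: modulus_const_def)

lemma integrable_potential:
  "integrable lborel (\<lambda>y. ln (norm (x - y)) / (2 * pi) * w y)"
proof (rule integrable_of_pole)
  show "AE y in lborel. \<bar>ln (norm (x - y)) / (2 * pi) * w y\<bar>
    \<le> (((norm x + R)\<^sup>2 + 1) * M / (2 * pi)) / norm (x - y) * indicator (cball 0 R) y"
    using AE_lborel_singleton[of x]
  proof eventually_elim
    case (elim y)
    define r where "r = norm (x - y)"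
    have r: "0 < r" using elim by (simp add: r_def)
    show ?case
    proof (cases "y \<in> cball 0 R")
      case True
      have "r \<le> norm x + R"
        using norm_triangle_ineq4[of x y] True by (simp add: r_def)
      then have r2: "r\<^sup>2 \<le> (norm x + R)\<^sup>2" using r by (intro power_mono) auto
      have "ln r \<le> r - 1" using r by (rule ln_le_minus_one)
      moreover have "ln (1 / r) \<le> 1 / r - 1" using r by (intro ln_le_minus_one) simp
      then have "- ln r \<le> 1 / r - 1" using r by (simp add: ln_div)
      moreover have "0 < 1 / r" using r by simp
      \<comment> \<open>The logarithmic singularity is weakened to a simple pole; the growth at
        large \<open>r\<close> is harmless because \<open>r\<close> is bounded on the
        support.\<close>
      ultimately have "\<bar>ln r\<bar> \<le> r + 1 / r" using r by linarith
      also have "\<dots> = (r\<^sup>2 + 1) / r" using r by (simp add: field_simps power2_eq_square)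
      also have "\<dots> \<le> ((norm x + R)\<^sup>2 + 1) / r"
        using r2 r by (intro divide_right_mono) auto
      finally have "\<bar>ln r\<bar> * \<bar>w y\<bar> / (2 * pi) \<le> ((norm x + R)\<^sup>2 + 1) / r * M / (2 * pi)"
        using w_le_M r by (intro divide_right_mono mult_mono) auto
      then show ?thesis using True by (simp add: abs_mult mult_ac flip: r_def)
    qed (use w_le[of y] in simp)
  qed
qed (use M in auto)

lemma integrable_biot_savart:
  "integrable lborel (\<lambda>y. directional_kernel e x y / (2 * pi) * w y)"
proof (rule integrable_of_pole)
  show "AE y in lborel. \<bar>directional_kernel e x y / (2 * pi) * w y\<bar>
    \<le> (norm e * M / (2 * pi)) / norm (x - y) * indicator (cball 0 R) y"
    using AE_lborel_singleton[of x]
  proof eventually_elim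
    case (elim y)
    have "\<bar>directional_kernel e x y\<bar> \<le> norm (x - y) * norm e / (norm (x - y))\<^sup>2"
      unfolding directional_kernel_def abs_divide by (simp add: Cauchy_Schwarz_ineq2 divide_right_mono)
    also have "\<dots> = norm e / norm (x - y)" using elim by (simp add: power2_eq_square)
    finally have "\<bar>directional_kernel e x y\<bar> * \<bar>w y\<bar> / (2 * pi)
      \<le> norm e / norm (x - y) * (M * indicator (cball 0 R) y) / (2 * pi)"
      using w_le by (intro divide_right_mono mult_mono) auto
    then show ?case by (simp add: abs_mult mult_ac)
  qed
qed (use M in \<open>auto simp: directional_kernel_def\<close>)

lemma inv_laplacian_first_order:
  assumes "h \<noteq> 0"
  shows "\<bar>inv_laplacian w (x + h) - inv_laplacian w x - biot_savart w h x\<bar>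
    \<le> 4 * M / pi * (norm h)\<^sup>2 * (modulus_const * log_mod (norm h))"
proof -
  define f where "f y = ln (norm (x + h - y)) / (2 * pi) * w y - ln (norm (x - y)) / (2 * pi) * w y
    - directional_kernel h x y / (2 * pi) * w y" for y
  have "inv_laplacian w (x + h) - inv_laplacian w x - biot_savart w h x = (LINT y|lborel. f y)"
    unfolding inv_laplacian_def biot_savart_def f_def
    by (subst Bochner_Integration.integral_diff, intro Bochner_Integration.integrable_diff
        integrable_potential, rule integrable_biot_savart)
      (subst Bochner_Integration.integral_diff; intro integrable_potential refl)
  also have "\<bar>\<dots>\<bar> \<le> (4 * M / pi * (norm h)\<^sup>2) * (modulus_const * log_mod (norm (x - (x + h))))"
  proof (rule integral_of_two_pole_cball_le)
    show "AE y in lborel. \<bar>f y\<bar>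
      \<le> 4 * M / pi * (norm h)\<^sup>2 * (two_pole x (x + h) y * indicator (cball 0 R) y)"
      using AE_lborel_singleton[of x] AE_lborel_singleton[of "x + h"]
    proof eventually_elim
      case (elim y)
      define T where "T = ln (norm (x - y + h)) - ln (norm (x - y)) - directional_kernel h x y"
      have "\<bar>T\<bar> \<le> 8 * (norm h)\<^sup>2 / (norm (x - y) * norm (x - y + h))"
        unfolding T_def directional_kernel_def
        using elim by (intro ln_norm_first_order) (auto simp: algebra_simps)
      then have "\<bar>T\<bar> * \<bar>w y\<bar> / (2 * pi)
        \<le> (8 * (norm h)\<^sup>2 / (norm (x - y) * norm (x - y + h))) * (M * indicator (cball 0 R) y) / (2 * pi)"
        using w_le by (intro divide_right_mono mult_mono) auto
      moreover have "f y = T * w y / (2 * pi)"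
        by (simp add: f_def T_def field_simps)
      ultimately show ?case by (simp add: abs_mult two_pole_def algebra_simps)
    qed
  qed (use assms M in \<open>auto simp: f_def directional_kernel_def\<close>)
  finally show ?thesis by simp
qed

text \<open>\<open>deriv\<close> is informative only where a derivative exists, so differentiability
  is derived first, from the first-order expansion along the axis.\<close>

lemma partial_deriv_inv_laplacian:
  "partial_deriv i (inv_laplacian w) x = biot_savart w (axis i 1) x"
proof -
  define \<psi> where "\<psi> s = inv_laplacian w (x + s *\<^sub>R axis i 1)" for s
  define D where "D = biot_savart w (axis i 1) x"
  define C where "C = 4 * M / pi * modulus_const"
  have bound: "\<bar>(\<psi> s - \<psi> 0) / s - D\<bar> \<le> C * (\<bar>s\<bar> * log_mod \<bar>s\<bar>)" if s: "s \<noteq> 0" for s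
  proof -
    have "\<bar>\<psi> s - \<psi> 0 - s * D\<bar> \<le> 4 * M / pi * s\<^sup>2 * (modulus_const * log_mod \<bar>s\<bar>)"
      using inv_laplacian_first_order[of "s *\<^sub>R axis i 1" x] s
      by (simp add: \<psi>_def D_def biot_savart_scaleR axis_eq_0_iff power_mult_distrib)
    then have "\<bar>\<psi> s - \<psi> 0 - s * D\<bar> / \<bar>s\<bar> \<le> 4 * M / pi * s\<^sup>2 * (modulus_const * log_mod \<bar>s\<bar>) / \<bar>s\<bar>"
      by (rule divide_right_mono) simp
    also have "\<dots> = C * (\<bar>s\<bar> * log_mod \<bar>s\<bar>)"
      using s by (simp add: C_def field_simps power2_eq_square) 
    also have "\<bar>\<psi> s - \<psi> 0 - s * D\<bar> / \<bar>s\<bar> = \<bar>(\<psi> s - \<psi> 0) / s - D\<bar>"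
      using s by (simp add: abs_divide[symmetric] diff_divide_distrib)
    finally show ?thesis .
  qed
  have "((\<lambda>s. (\<psi> s - \<psi> 0) / s - D) \<longlongrightarrow> 0) (at 0)"
  proof (rule Lim_null_comparison)
    show "\<forall>\<^sub>F s in at 0. norm ((\<psi> s - \<psi> 0) / s - D) \<le> C * (\<bar>s\<bar> * log_mod \<bar>s\<bar>)"
      using bound by (auto simp: eventually_at_filter)
    show "((\<lambda>s. C * (\<bar>s\<bar> * log_mod \<bar>s\<bar>)) \<longlongrightarrow> 0) (at 0)"
      by (rule tendsto_mult_right_zero[OF tendsto_mult_log_mod])
  qed
  then have "(\<psi> has_field_derivative D) (at 0)"
    by (simp add: has_field_derivative_iff LIM_zero_iff)
  then show ?thesis
    unfolding partial_deriv_def D_def \<psi>_def by (rule DERIV_imp_deriv)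
qed

lemma biot_savart_diff_le:
  assumes "x \<noteq> x'"
  shows "\<bar>biot_savart w e x - biot_savart w e x'\<bar>
    \<le> norm e * norm (x - x') * M / (2 * pi) * (modulus_const * log_mod (norm (x - x')))"
proof -
  define f where "f y = directional_kernel e x y / (2 * pi) * w y
    - directional_kernel e x' y / (2 * pi) * w y" for y
  have "biot_savart w e x - biot_savart w e x' = (LINT y|lborel. f y)"
    unfolding biot_savart_def f_def 
    by (intro Bochner_Integration.integral_diff[symmetric] integrable_biot_savart)
  also have "\<bar>\<dots>\<bar> \<le> (norm e * norm (x - x') * M / (2 * pi)) * (modulus_const * log_mod (norm (x - x')))"
  proof (rule integral_of_two_pole_cball_le[OF _ assms])
    show "AE y in lborel. \<bar>f y\<bar> \<le> norm e * norm (x - x') * M / (2 * pi)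
        * (two_pole x x' y * indicator (cball 0 R) y)"
      using AE_lborel_singleton[of x] AE_lborel_singleton[of x']
    proof eventually_elim
      case (elim y)
      have "\<bar>directional_kernel e x y - directional_kernel e x' y\<bar> * \<bar>w y\<bar> / (2 * pi)
        \<le> (norm e * norm (x - x') * two_pole x x' y) * (M * indicator (cball 0 R) y) / (2 * pi)"
        using w_le directional_kernel_diff_le[OF elim]
        by (intro divide_right_mono mult_mono) (auto simp: two_pole_def)
      moreover have "f y = (directional_kernel e x y - directional_kernel e x' y) * w y / (2 * pi)"
        by (simp add: f_def field_simps)
      ultimately show ?case by (simp add: abs_mult mult_ac)
    qed
  qed (use M in \<open>auto simp: f_def directional_kernel_def\<close>)
  finally show ?thesis .
qed

lemma velocity_log_Lipschitz:
  assumes "x \<noteq> x'"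
  shows "norm (velocity w x - velocity w x')
    \<le> M / pi * modulus_const * norm (x - x') * log_mod (norm (x - x'))"
proof -
  \<comment> \<open>Each of the two components contributes a factor \<open>M / (2 * pi)\<close>,
    hence \<open>M / pi\<close> in total.\<close>
  have "norm (velocity w x - velocity w x') \<le> (\<Sum>i\<in>UNIV. \<bar>(velocity w x - velocity w x') $ i\<bar>)"
    by (rule norm_le_l1_cart)
  also have "\<dots> = \<bar>biot_savart w (axis 2 1) x - biot_savart w (axis 2 1) x'\<bar>
      + \<bar>biot_savart w (axis 1 1) x - biot_savart w (axis 1 1) x'\<bar>"
    by (simp add: sum_2 velocity_def perp_grad_def partial_deriv_inv_laplacian)
  also have "\<dots> \<le> norm (x - x') * M / (2 * pi) * (modulus_const * log_mod (norm (x - x')))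
     + norm (x - x') * M / (2 * pi) * (modulus_const * log_mod (norm (x - x')))"
    using biot_savart_diff_le[OF assms, of "axis 1 1"] biot_savart_diff_le[OF assms, of "axis 2 1"]
    by (intro add_mono) simp_all
  also have "\<dots> = M / pi * modulus_const * norm (x - x') * log_mod (norm (x - x'))"
    by (simp add: field_simps)
  finally show ?thesis .
qed

end

section \<open>Gronwall estimate along trajectories and uniform bounds on the vorticity\<close>

lemma log_mod_norm: "log_mod (norm v) = 1 + ln (1 + 1 / (v \<bullet> v))"
  by (simp add: log_mod_def power2_norm_eq_inner)

lemma log_mod_Gronwall:
  fixes X Y :: "real \<Rightarrow> 'a :: real_inner"
  assumes t: "0 \<le> t" and A: "0 \<le> A"
    and X: "\<And>s. 0 \<le> s \<Longrightarrow> (X has_vector_derivative X' s) (at s within {0..})"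
    and Y: "\<And>s. 0 \<le> s \<Longrightarrow> (Y has_vector_derivative Y' s) (at s within {0..})"
    and neq: "\<And>s. 0 \<le> s \<Longrightarrow> X s \<noteq> Y s"
    and le: "\<And>s. 0 \<le> s \<Longrightarrow> s \<le> t \<Longrightarrow>
      norm (X' s - Y' s) \<le> A * norm (X s - Y s) * log_mod (norm (X s - Y s))"
  shows "log_mod (norm (X t - Y t)) \<le> exp (2 * A * t) * log_mod (norm (X 0 - Y 0))"
proof -
  define v where "v s = X s - Y s" for s
  define v' where "v' s = X' s - Y' s" for s
  define q where "q s = v s \<bullet> v s" for s
  \<comment> \<open>The weight of the squared distance, damped by the expected growth factor; the
    claim is that \<open>g\<close> does not increase. Working with \<open>q\<close> avoids
    differentiating the norm.\<close>
  define g where "g s = (1 + ln (1 + 1 / q s)) * exp (- (2 * A * s))" for s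
  have q: "0 < q s" if "0 \<le> s" for s
    using neq[OF that] by (simp add: q_def v_def)
  have "(v has_vector_derivative v' s) (at s within {0..})" if "0 \<le> s" for s
    unfolding v_def v'_def by (intro has_vector_derivative_diff X Y that)
  then have dq: "(q has_real_derivative 2 * (v s \<bullet> v' s)) (at s within {0..})" if "0 \<le> s" for s
    using bounded_bilinear.has_vector_derivative[OF bounded_bilinear_inner, of v "v' s" s "{0..}" v "v' s"] that
    by (simp add: q_def[abs_def] has_real_derivative_iff_has_vector_derivative inner_commute)
  define g' where "g' s = (- (2 * (v s \<bullet> v' s)) / (q s * q s + q s) - 2 * A * (1 + ln (1 + 1 / q s)))
      * exp (- (2 * A * s))" for s
  have dg: "(g has_real_derivative g' s) (at s within {0..})" if s: "0 \<le> s" for s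
  proof -
    have pos: "0 < 1 + 1 / q s" "0 < q s" "0 < q s * q s + q s" using q[OF s] by (auto simp: add_pos_pos)
    have D: "(g has_real_derivative
      (inverse (1 + 1 / q s) * (- (2 * (v s \<bullet> v' s)) / (q s * q s))) * exp (- (2 * A * s))
        + (- (2 * A) * exp (- (2 * A * s))) * (1 + ln (1 + 1 / q s))) (at s within {0..})"
      unfolding g_def using pos
      by (auto intro!: derivative_eq_intros dq[OF s] simp: divide_inverse)
    have eq: "inverse (1 + 1 / q s) * (- (2 * (v s \<bullet> v' s)) / (q s * q s))
      = - (2 * (v s \<bullet> v' s)) / (q s * q s + q s)"
    proof -
      have "(1 + 1 / q s) * (q s * q s) = q s * q s + q s" using pos by (simp add: field_simps)
      then show ?thesis by (simp add: divide_inverse flip: inverse_mult_distrib)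
    qed
    show ?thesis
      by (rule DERIV_cong[OF D]) (unfold eq g'_def, simp add: algebra_simps)
  qed
  have g'_le: "g' s \<le> 0" if s: "0 \<le> s" "s \<le> t" for s
  proof -
    define L where "L = log_mod (norm (v s))"
    have L: "L = 1 + ln (1 + 1 / q s)" by (simp add: L_def log_mod_norm q_def)
    have L1: "1 \<le> L" unfolding L_def by (rule log_mod_ge_1)
    have "- (2 * (v s \<bullet> v' s)) \<le> 2 * (norm (v s) * norm (v' s))"
      using Cauchy_Schwarz_ineq2[of "v s" "v' s"] by linarith
    also have "\<dots> \<le> 2 * (norm (v s) * (A * norm (v s) * L))"
      using le[OF s] by (intro mult_left_mono) (auto simp: v_def v'_def L_def)
    also have "\<dots> = 2 * A * L * q s"
      by (simp add: q_def power2_norm_eq_inner[symmetric] power2_eq_square)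
    \<comment> \<open>Enlarging \<open>q\<close> to \<open>q\<^sup>2 + q\<close> matches the
      denominator produced by differentiating \<open>ln (1 + 1 / q)\<close>.\<close>
    also have "\<dots> \<le> 2 * A * L * (q s * q s + q s)"
      using A L1 q[OF s(1)] by (intro mult_left_mono) auto
    finally have "- (2 * (v s \<bullet> v' s)) / (q s * q s + q s) \<le> 2 * A * L"
      using q[OF s(1)] by (subst pos_divide_le_eq) (simp_all add: add_pos_pos)
    then show ?thesis unfolding g'_def L[symmetric] by (simp add: mult_nonpos_nonneg)
  qed
  have "g t \<le> g 0"
  \<comment> \<open>At time 0 only a one-sided derivative is available, so the sign is checked in
    the open interval and continuity covers the endpoints.\<close>
  proof (rule DERIV_nonpos_imp_decreasing_open[where f = g, OF t])
    show "\<exists>y. (g has_real_derivative y) (at s) \<and> y \<le> 0" if "0 < s" "s < t" for s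
    proof -
      have "at s within {0..} = at s" using that by (intro at_within_interior) simp
      then show ?thesis using dg[of s] g'_le[of s] that by auto
    qed
    show "continuous_on {0..t} g"
      by (rule continuous_on_subset[OF DERIV_continuous_on[OF dg]]) auto
  qed
  then show ?thesis
    by (simp add: g_def log_mod_norm q_def v_def exp_minus field_simps)
qed

text \<open>Transport preserves the values, so \<open>M\<close> comes from the initial data. The
  support stays in the image of \<open>{0..T} \<times> K\<close> under the jointly continuous flow,
  which is compact and yields one \<open>R\<close> for all these times.\<close>

lemma yudovich_solution_bounded_vorticity:
  assumes yud: "yudovich_solution \<omega>"
    and flow: "is_flow_map (\<lambda>t. velocity (\<omega> t)) \<Phi>"
    and transport: "\<And>t x. 0 \<le> t \<Longrightarrow> \<omega> t x = \<omega> 0 (inv (\<Phi> t) x)"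
  obtains M R where "\<And>s. 0 \<le> s \<Longrightarrow> s \<le> T \<Longrightarrow> bounded_vorticity (\<omega> s) M R"
proof -
  define K where "K = closure {x. \<omega> 0 x \<noteq> 0}"
  have "bounded (range (\<omega> 0))" and K: "compact K"
    using yud by (auto simp: yudovich_solution_def K_def)
  then obtain M where M: "\<And>x. \<bar>\<omega> 0 x\<bar> \<le> M" by (auto simp: bounded_iff)
  have M0: "0 \<le> M" using M[of 0] by linarith
  have "compact ((\<lambda>(t, x). \<Phi> t x) ` ({0..T} \<times> K))"
    using flow K unfolding is_flow_map_def
    by (intro compact_continuous_image compact_Times compact_Icc) (auto intro: continuous_on_subset)
  then obtain R where R: "\<forall>p\<in>(\<lambda>(t, x). \<Phi> t x) ` ({0..T} \<times> K). norm p \<le> R"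
    using compact_imp_bounded bounded_iff by blast
  have "bounded_vorticity (\<omega> s) M R" if s: "0 \<le> s" "s \<le> T" for s
  proof
    show "\<omega> s \<in> borel_measurable borel" using yud s by (auto simp: yudovich_solution_def)
    show "0 \<le> M" by (rule M0)
    fix y
    show "\<bar>\<omega> s y\<bar> \<le> M * indicator (cball 0 R) y"
    proof (cases "\<omega> s y = 0")
      case False
      define x where "x = inv (\<Phi> s) y"
      have "bij (\<Phi> s)" using flow s by (auto simp: is_flow_map_def)
      then have y: "y = \<Phi> s x" unfolding x_def by (simp add: bij_is_surj surj_f_inv_f)
      have "x \<in> K" using False transport[OF s(1), of y]
        closure_subset[of "{x. \<omega> 0 x \<noteq> 0}"] by (auto simp: K_def x_def)
      then have "norm y \<le> R" using s by (intro R[rule_format]) (auto simp: y intro!: image_eqI[of _ _ "(s, x)"])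
      then show ?thesis using M transport[OF s(1), of y] by simp
    qed (use M0 in simp)
  qed
  then show thesis by (rule that)
qed

text \<open>Since \<open>log_mod\<close> decreases in the distance, this limits how fast
  trajectories can approach each other: points close at time \<open>t\<close> started close.
  Injectivity of the flow keeps them distinct.\<close>

lemma flow_log_mod_le:
  assumes flow: "is_flow_map u \<Phi>" and t: "0 \<le> t" and A: "0 \<le> A" and ab: "a \<noteq> b"
    and u: "\<And>s x y. 0 \<le> s \<Longrightarrow> s \<le> t \<Longrightarrow> x \<noteq> y \<Longrightarrow>
      norm (u s x - u s y) \<le> A * norm (x - y) * log_mod (norm (x - y))"
  shows "log_mod (norm (\<Phi> t a - \<Phi> t b)) \<le> exp (2 * A * t) * log_mod (norm (a - b))"
proof -
  have neq: "\<Phi> s a \<noteq> \<Phi> s b" if "0 \<le> s" for s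
    using flow ab that by (auto simp: is_flow_map_def bij_def inj_eq)
  have "log_mod (norm (\<Phi> t a - \<Phi> t b)) \<le> exp (2 * A * t) * log_mod (norm (\<Phi> 0 a - \<Phi> 0 b))"
    by (rule log_mod_Gronwall[OF t A, where X' = "\<lambda>s. u s (\<Phi> s a)" and Y' = "\<lambda>s. u s (\<Phi> s b)"])
      (use flow neq u in \<open>auto simp: is_flow_map_def\<close>)
  then show ?thesis using flow by (simp add: is_flow_map_def)
qed

section \<open>Comparison of \<open>log_mod\<close> with \<open>\<bar>ln d\<bar>\<close> and
  propagation of the modulus\<close>

lemma abs_ln_le_log_mod:
  assumes "0 < d" "d \<le> 1"
  shows "2 * \<bar>ln d\<bar> \<le> log_mod d"
proof -
  have "2 * \<bar>ln d\<bar> = ln (1 / d\<^sup>2)" using assms by (simp add: ln_div ln_realpow)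
  also have "\<dots> \<le> ln (1 + 1 / d\<^sup>2)" using assms by (intro ln_mono) auto
  finally show ?thesis by (simp add: log_mod_def)
qed

lemma log_mod_le_abs_ln:
  assumes "0 < d" "d \<le> 1/2"
  shows "log_mod d \<le> 5 * \<bar>ln d\<bar>"
proof -
  \<comment> \<open>The constant 5 arises from \<open>1 \<le> 2 * ln 2\<close>: the sum
    \<open>1 + ln 2 - 2 * ln d\<close> is at most \<open>3 * ln 2 - 2 * ln d\<close>, and
    \<open>ln 2 \<le> - ln d\<close>.\<close>
  have "1/2 \<le> (ln 2 :: real)" using ln_le_minus_one[of "1/2 :: real"] by (simp add: ln_div)
  moreover have "ln d \<le> ln (1/2)" using assms by (intro ln_mono) auto
  then have "ln 2 \<le> - ln d" by (simp add: ln_div)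
  moreover have "ln (1 + 1 / d\<^sup>2) \<le> ln (2 / d\<^sup>2)"
  proof (rule ln_mono)
    have "d\<^sup>2 \<le> 1" using assms by (simp add: power_le_one)
    then show "1 + 1 / d\<^sup>2 \<le> 2 / d\<^sup>2" using assms by (simp add: field_simps)
  qed (use assms in \<open>simp add: add_pos_pos\<close>)
  then have "ln (1 + 1 / d\<^sup>2) \<le> ln 2 - 2 * ln d"
    using assms by (simp add: ln_div ln_realpow)
  ultimately have "1 + ln (1 + 1 / d\<^sup>2) \<le> 5 * (- ln d)" by argo
  moreover have "\<bar>ln d\<bar> = - ln d" using assms by simp
  ultimately show ?thesis by (simp add: log_mod_def)
qed

lemma log_mod_le_5:
  assumes "1/2 \<le> d"
  shows "log_mod d \<le> 5"
proof -
  have "(1/2)\<^sup>2 \<le> d\<^sup>2" using assms by (intro power_mono) auto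
  then have "1 / d\<^sup>2 \<le> 4" using assms by (simp add: power2_eq_square field_simps)
  moreover have "ln (1 + 1 / d\<^sup>2) \<le> 1 / d\<^sup>2" by (intro ln_add_one_self_le_self) auto
  ultimately show ?thesis by (simp add: log_mod_def)
qed

theorem proposition3p1:
  fixes \<gamma> :: real and \<omega> :: "real \<Rightarrow> real^2 \<Rightarrow> real"
  assumes "0 < \<gamma>" and "\<gamma> < 1"
    and "yudovich_solution \<omega>"
    and "\<And>x y. x \<noteq> y \<Longrightarrow> norm (x - y) \<le> 1/2 \<Longrightarrow>
           \<bar>\<omega> 0 x - \<omega> 0 y\<bar> \<le> 1 / \<bar>ln (norm (x - y))\<bar> powr \<gamma>"
  shows "\<forall>t\<ge>0. \<exists>C. \<forall>x y. x \<noteq> y \<longrightarrow> norm (x - y) \<le> 1/2 \<longrightarrow>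
           \<bar>\<omega> t x - \<omega> t y\<bar> \<le> C / \<bar>ln (norm (x - y))\<bar> powr \<gamma>"
proof (intro allI impI)
  fix t :: real
  assume t: "0 \<le> t"
  obtain \<Phi> where flow: "is_flow_map (\<lambda>t. velocity (\<omega> t)) \<Phi>"
    and transport: "\<And>t x. 0 \<le> t \<Longrightarrow> \<omega> t x = \<omega> 0 (inv (\<Phi> t) x)"
    using assms(3) by (auto simp: yudovich_solution_def)
  obtain M R where bv: "\<And>s. 0 \<le> s \<Longrightarrow> s \<le> t \<Longrightarrow> bounded_vorticity (\<omega> s) M R"
    using yudovich_solution_bounded_vorticity[OF assms(3) flow transport] by metis
  have M: "0 \<le> M" and w0: "\<And>x. \<bar>\<omega> 0 x\<bar> \<le> M"
    using bv[of 0] t bounded_vorticity.M bounded_vorticity.w_le_M by auto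
  define A where "A = M / pi * bounded_vorticity.modulus_const R"
  have A: "0 \<le> A"
    using M unfolding A_def bounded_vorticity.modulus_const_def[OF bv[OF order_refl t]] by simp
  \<comment> \<open>The factor 5 serves both \<open>log_mod_le_abs_ln\<close> for close preimages
    and \<open>log_mod_le_5\<close> for distant ones.\<close>
  define E where "E = 5 * exp (2 * A * t)"
  have E: "0 < E" by (simp add: E_def)
  \<comment> \<open>In the prefactor, 1 covers close preimages, where the initial modulus applies,
    and \<open>2 * M\<close> covers distant ones.\<close>
  have "\<bar>\<omega> t x - \<omega> t y\<bar> \<le> (1 + 2 * M) * E powr \<gamma> / \<bar>ln (norm (x - y))\<bar> powr \<gamma>"
    if xy: "x \<noteq> y" "norm (x - y) \<le> 1/2" for x y
  proof -
    define a b where "a = inv (\<Phi> t) x" and "b = inv (\<Phi> t) y"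
    have "bij (\<Phi> t)" using flow t by (auto simp: is_flow_map_def)
    then have x: "x = \<Phi> t a" and y: "y = \<Phi> t b"
      unfolding a_def b_def by (simp_all add: bij_is_surj surj_f_inv_f)
    have ab: "a \<noteq> b" using xy x y by auto
    have \<omega>: "\<omega> t x = \<omega> 0 a" "\<omega> t y = \<omega> 0 b" using transport[OF t] by (auto simp: a_def b_def)
    define l where "l = \<bar>ln (norm (x - y))\<bar>"
    have l: "0 < l" using xy by (simp add: l_def)
    have "log_mod (norm (x - y)) \<le> exp (2 * A * t) * log_mod (norm (a - b))"
      unfolding x y
    proof (rule flow_log_mod_le[OF flow t A ab])
      show "norm (velocity (\<omega> s) x - velocity (\<omega> s) y) \<le> A * norm (x - y) * log_mod (norm (x - y))"
        if "0 \<le> s" "s \<le> t" "x \<noteq> y" for s x y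
        unfolding A_def by (rule bounded_vorticity.velocity_log_Lipschitz[OF bv[OF that(1,2)] that(3)])
    qed
    moreover have "2 * l \<le> log_mod (norm (x - y))"
      unfolding l_def using xy by (intro abs_ln_le_log_mod) auto
    ultimately have le: "l \<le> exp (2 * A * t) * log_mod (norm (a - b))" using l by linarith
    have "\<bar>\<omega> 0 a - \<omega> 0 b\<bar> \<le> (1 + 2 * M) * (E / l) powr \<gamma>"
    proof (cases "norm (a - b) \<le> 1/2")
      case True
      define m where "m = \<bar>ln (norm (a - b))\<bar>"
      have m: "0 < m" using True ab by (simp add: m_def)
      have "exp (2 * A * t) * log_mod (norm (a - b)) \<le> exp (2 * A * t) * (5 * m)"
        unfolding m_def using True ab by (intro mult_left_mono log_mod_le_abs_ln) auto
      also have "\<dots> = E * m" by (simp add: E_def)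
      finally have "l \<le> E * m" using le by linarith
      then have *: "1 / m \<le> E / l" using l m by (simp add: field_simps)
      have "\<bar>\<omega> 0 a - \<omega> 0 b\<bar> \<le> 1 / m powr \<gamma>"
        unfolding m_def by (rule assms(4)[OF ab True])
      also have "\<dots> = (1 / m) powr \<gamma>" using m by (simp add: powr_divide)
      also have "\<dots> \<le> (E / l) powr \<gamma>" using * m assms(1) by (intro powr_mono2) auto
      also have "\<dots> \<le> (1 + 2 * M) * (E / l) powr \<gamma>" using M by (simp add: algebra_simps)
      finally show ?thesis .
    next
      case False
      have "exp (2 * A * t) * log_mod (norm (a - b)) \<le> exp (2 * A * t) * 5"
        using False by (intro mult_left_mono log_mod_le_5) auto
      also have "\<dots> = E" by (simp add: E_def)
      \<comment> \<open>Distant preimages force \<open>l \<le> E\<close>, so the images are not too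
        close and the trivial bound by the supremum suffices.\<close>
      finally have "1 \<le> E / l" using le l by (simp add: pos_le_divide_eq)
      then have *: "1 \<le> (E / l) powr \<gamma>" using assms(1) by (intro ge_one_powr_ge_zero) auto
      have "\<bar>\<omega> 0 a - \<omega> 0 b\<bar> \<le> (1 + 2 * M) * 1"
        using abs_triangle_ineq4[of "\<omega> 0 a" "\<omega> 0 b"] w0[of a] w0[of b] by simp
      also have "\<dots> \<le> (1 + 2 * M) * (E / l) powr \<gamma>"
        using * M by (intro mult_left_mono) auto
      finally show ?thesis .
    qed
    then show ?thesis
      using E l by (simp add: \<omega> powr_divide flip: l_def)
  qed
  then show "\<exists>C. \<forall>x y. x \<noteq> y \<longrightarrow> norm (x - y) \<le> 1/2 \<longrightarrow>
      \<bar>\<omega> t x - \<omega> t y\<bar> \<le> C / \<bar>ln (norm (x - y))\<bar> powr \<gamma>"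
    by blast
qed

end
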